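(* For every integer $n\geq 2$, $$M(n)\geq\frac{n^2}{\mathfrak{N}(n^2)}.$$
   Context: For a positive integer $n$, $M(n)=\#\{ij : i,j\in\mathbb{N},\ 1\leq i\leq n,\ 1\leq j\leq n\}$ is the number of distinct entries in the $n\times n$ multiplication table. The function $\mathfrak{N}$ is defined for integers $m\geq 3$ by $$\mathfrak{N}(m)=m^{\frac{\log 2}{\log\log m}\left(1+\frac{387}{200\log\log m}\right)},$$ where $\log$ denotes the natural logarithm. *)

theory Defs
  imports Complex_Main
begin

definition mult_table_count :: "nat \<Rightarrow> nat" where
  "mult_table_count n = card {i * j | i j. 1 \<le> i \<and> i \<le> n \<and> 1 \<le> j \<and> j \<le> n}"

text \<open>Meaningful only for \<open>m \<ge> 3\<close>, where \<open>ln (ln m) > 0\<close>.\<close>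

definition frakN :: "nat \<Rightarrow> real" where
  "frakN m = real m powr (ln 2 / ln (ln (real m)) * (1 + 387 / (200 * ln (ln (real m)))))"

end

theory Submission
  imports Defs "HOL-Analysis.Convex" "HOL-Analysis.Harmonic_Numbers"
begin

text \<open>
  The products \<open>i * j\<close> coincide rarely on average: a second-moment argument shows that the number
  of distinct ones falls short of \<open>n\<^sup>2\<close> by at most a factor \<open>1 + 2 * ln n\<close>, whereas
  \<open>frakN (n\<^sup>2)\<close> grows faster than every power of \<open>ln n\<close>.

  Let \<open>r k\<close> be the number of ways to write \<open>k = i * j\<close> with \<open>i, j \<le> n\<close>. Then \<open>r\<close> has total mass
  \<open>n\<^sup>2\<close>, so the Cauchy--Schwarz inequality bounds \<open>n\<^sup>4\<close> by \<open>mult_table_count n\<close> times the second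
  moment of \<open>r\<close> (\<open>card_squared_le_card_image_mult_collisions\<close>). That second moment is the
  multiplicative energy, the number of solutions of \<open>a * b = c * d\<close> in \<open>{1..n}\<close>. Every solution
  factors as \<open>a = g * x\<close>, \<open>c = g * y\<close>, \<open>b = y * h\<close>, \<open>d = x * h\<close> with \<open>x / y\<close> in lowest terms, and
  \<open>g\<close> and \<open>h\<close> are at most \<open>n / max x y\<close>; summing over \<open>x\<close> and \<open>y\<close> gives at most
  \<open>n\<^sup>2 * (1 + 2 * ln n)\<close> solutions (\<open>mult_energy_le\<close>). Hence
  \<open>mult_table_count n \<ge> n\<^sup>2 / (1 + 2 * ln n)\<close>.

  With \<open>L = ln (n\<^sup>2)\<close> it remains to see that \<open>1 + L \<le> frakN (n\<^sup>2)\<close>, an elementary inequality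
  in one real variable that holds as soon as \<open>L > 1\<close> (\<open>one_plus_ln_le_frakN\<close>).
\<close>

section \<open>Images and collisions\<close>

text \<open>
  The number of pairs with equal image is the sum of the squares of the fibre sizes, while
  the fibre sizes themselves add up to the size of the domain.
\<close>

lemma card_squared_le_card_image_mult_collisions:
  fixes f :: "'a \<Rightarrow> 'b"
  assumes "finite P"
  shows "real (card P) ^ 2
           \<le> real (card (f ` P)) * real (card {(p, q). p \<in> P \<and> q \<in> P \<and> f p = f q})"
proof -
  define fibre where "fibre k = {p \<in> P. f p = k}" for k
  have fin: "finite (fibre k)" for k
    using assms by (simp add: fibre_def)
  have "card P = (\<Sum>k\<in>f ` P. card (fibre k))"
    using sum.image_gen[OF assms, of "\<lambda>_. 1::nat" f] by (simp add: fibre_def)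
  hence mass: "real (card P) = (\<Sum>k\<in>f ` P. real (card (fibre k)))"
    by simp
  have "{(p, q). p \<in> P \<and> q \<in> P \<and> f p = f q} = (\<Union>k\<in>f ` P. fibre k \<times> fibre k)"
    by (auto simp: fibre_def)
  also have "card \<dots> = (\<Sum>k\<in>f ` P. card (fibre k \<times> fibre k))"
    by (rule card_UN_disjoint) (use assms fin in \<open>auto simp: fibre_def\<close>)
  finally have energy: "real (card {(p, q). p \<in> P \<and> q \<in> P \<and> f p = f q})
      = (\<Sum>k\<in>f ` P. real (card (fibre k)) ^ 2)"
    by (simp add: card_cartesian_product power2_eq_square)
  show ?thesis
    unfolding mass energy
    using sum_squared_le_sum_of_squares[of "\<lambda>k. real (card (fibre k))" "f ` P"]
    by (simp add: mult.commute)
qed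

section \<open>The multiplicative energy of an interval\<close>

text \<open>
  A superset of the coprime pairs in \<open>{1..n}\<close> that is easy to sum over: of coprimality only its
  consequence on the diagonal is kept.
\<close>

definition ratio_pairs :: "nat \<Rightarrow> (nat \<times> nat) set" where
  "ratio_pairs n = {(x, y). x \<in> {1..n} \<and> y \<in> {1..n} \<and> (x = y \<longrightarrow> x = 1)}"

lemma finite_ratio_pairs [simp]: "finite (ratio_pairs n)"
  by (rule finite_subset[of _ "{1..n} \<times> {1..n}"]) (auto simp: ratio_pairs_def)

text \<open>
  The term \<open>1\<close> comes from the only diagonal pair \<open>(1, 1)\<close>. Passing from \<open>n\<close> to \<open>n + 1\<close> adds the
  \<open>2 * n\<close> pairs whose maximum is \<open>n + 1\<close>; they contribute at most \<open>2 / (n + 1)\<close>, which is at most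
  \<open>2 * (ln (n + 1) - ln n)\<close>.
\<close>

lemma sum_ratio_pairs_le:
  assumes "n \<ge> 1"
  shows "(\<Sum>(x, y)\<in>ratio_pairs n. 1 / real (max x y) ^ 2) \<le> 1 + 2 * ln (real n)"
  using assms
proof (induction n rule: dec_induct)
  case base
  have "ratio_pairs 1 = {(1, 1)}"
    by (auto simp: ratio_pairs_def)
  thus ?case by simp
next
  case (step n)
  let ?w = "\<lambda>(x, y). 1 / real (max x y) ^ 2"
  have split: "ratio_pairs (Suc n)
      = ratio_pairs n \<union> ({Suc n} \<times> {1..n} \<union> {1..n} \<times> {Suc n})"
    using step.hyps by (auto simp: ratio_pairs_def)
  have row: "sum ?w ({Suc n} \<times> {1..n}) = real n / real (Suc n) ^ 2"
  proof -
    have "sum ?w ({Suc n} \<times> {1..n}) = (\<Sum>p\<in>{Suc n} \<times> {1..n}. 1 / real (Suc n) ^ 2)"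
      by (rule sum.cong) (auto simp: max_def)
    thus ?thesis by simp
  qed
  have column: "sum ?w ({1..n} \<times> {Suc n}) = real n / real (Suc n) ^ 2"
  proof -
    have "sum ?w ({1..n} \<times> {Suc n}) = (\<Sum>p\<in>{1..n} \<times> {Suc n}. 1 / real (Suc n) ^ 2)"
      by (rule sum.cong) (auto simp: max_def)
    thus ?thesis by simp
  qed
  have "sum ?w (ratio_pairs (Suc n))
      = sum ?w (ratio_pairs n) + sum ?w ({Suc n} \<times> {1..n} \<union> {1..n} \<times> {Suc n})"
    unfolding split
    by (rule sum.union_disjoint[OF finite_ratio_pairs]) (auto simp: ratio_pairs_def)
  also have "sum ?w ({Suc n} \<times> {1..n} \<union> {1..n} \<times> {Suc n})
      = sum ?w ({Suc n} \<times> {1..n}) + sum ?w ({1..n} \<times> {Suc n})"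
    by (rule sum.union_disjoint) auto
  finally have new: "sum ?w (ratio_pairs (Suc n))
      = sum ?w (ratio_pairs n) + 2 * (real n / real (Suc n) ^ 2)"
    using row column by simp
  have "real n / real (Suc n) ^ 2 \<le> 1 / real (Suc n)"
    by (simp add: divide_simps power2_eq_square)
  also have "\<dots> \<le> ln (real (Suc n)) - ln (real n)"
  proof -
    have "ln (real n / real (Suc n)) \<le> real n / real (Suc n) - 1"
      using step.hyps by (intro ln_le_minus_one) auto
    moreover have "ln (real n / real (Suc n)) = ln (real n) - ln (real (Suc n))"
      using step.hyps by (simp add: ln_div)
    moreover have "real n / real (Suc n) - 1 = - (1 / real (Suc n))"
      by (simp add: field_simps)
    ultimately show ?thesis by linarith
  qed
  finally show ?case using new step.IH by simp
qed

text \<open>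
  Parametrisation of the solutions of \<open>a * b = c * d\<close>: reduce the fraction \<open>a / c\<close> to lowest terms
  \<open>x / y\<close>. The equation then reads \<open>x * b = y * d\<close>, so coprimality makes \<open>y\<close> divide \<open>b\<close>.
\<close>

lemma equal_products_factorisation:
  fixes a b c d :: nat
  assumes "a * b = c * d" "a > 0" "c > 0"
  obtains x y g h where "coprime x y"
    "a = g * x" "c = g * y" "b = y * h" "d = x * h"
proof -
  define g where "g = gcd a c"
  have "g \<noteq> 0" using assms by (simp add: g_def)
  then obtain x y where "a = x * g" "c = y * g" and cop: "coprime x y"
    using gcd_coprime_exists[of a c] unfolding g_def by blast
  hence xy: "a = g * x" "c = g * y" by (simp_all only: mult.commute)
  have "y > 0" using xy(2) assms(3) by (cases y) auto
  have eq: "x * b = y * d"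
    using assms(1) \<open>g \<noteq> 0\<close> unfolding xy by (simp add: mult.assoc)
  hence "y dvd x * b" by simp
  hence "y dvd b"
    using cop by (simp add: coprime_dvd_mult_right_iff coprime_commute)
  then obtain h where h: "b = y * h" by (elim dvdE)
  have "d = x * h"
    using eq \<open>y > 0\<close> unfolding h by (simp add: mult.left_commute)
  with cop xy h show ?thesis by (intro that)
qed

text \<open>
  The factorisation makes the set of solutions an image of the set of admissible
  \<open>((x, y), (g, h))\<close>. All of \<open>g * x\<close>, \<open>g * y\<close>, \<open>h * x\<close>, \<open>h * y\<close> are at most \<open>n\<close>, so a given ratio
  \<open>(x, y)\<close> accounts for at most \<open>(n / max x y)\<^sup>2\<close> solutions.
\<close>

lemma mult_energy_le:
  assumes "n \<ge> 1"
  shows "real (card {(p, q). p \<in> {1..n} \<times> {1..n} \<and> q \<in> {1..n} \<times> {1..n}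
                              \<and> fst p * snd p = fst q * snd q})
           \<le> real n ^ 2 * (1 + 2 * ln (real n))"
proof -
  define box where "box = (\<lambda>(x, y). {1..n div max x y} \<times> {1..n div max x y})"
  define params where "params = Sigma (ratio_pairs n) box"
  define quad :: "(nat \<times> nat) \<times> (nat \<times> nat) \<Rightarrow> (nat \<times> nat) \<times> (nat \<times> nat)" where
    "quad = (\<lambda>((x, y), (g, h)). ((g * x, y * h), (g * y, x * h)))"
  have fin: "finite params"
    by (auto simp: params_def box_def intro!: finite_SigmaI)
  have "{(p, q). p \<in> {1..n} \<times> {1..n} \<and> q \<in> {1..n} \<times> {1..n} \<and> fst p * snd p = fst q * snd q}
      \<subseteq> quad ` params" (is "?E \<subseteq> _")
  proof
    fix z assume "z \<in> ?E"
    then obtain a b c d where z: "z = ((a, b), (c, d))"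
      and range: "a \<in> {1..n}" "b \<in> {1..n}" "c \<in> {1..n}" "d \<in> {1..n}"
      and eq: "a * b = c * d"
      by (cases z) auto
    have "a > 0" "c > 0" using range by auto
    from equal_products_factorisation[OF eq this]
    obtain x y g h where cop: "coprime x y"
      and abcd: "a = g * x" "c = g * y" "b = y * h" "d = x * h"
      by blast
    have pos: "x \<ge> 1" "y \<ge> 1" "g \<ge> 1" "h \<ge> 1"
      using range unfolding abcd by (auto simp: Suc_le_eq)
    have "g * max x y \<le> n" "h * max x y \<le> n"
      using range unfolding abcd by (auto simp: max_def mult.commute)
    hence gh: "g \<le> n div max x y" "h \<le> n div max x y"
      using pos by (simp_all add: less_eq_div_iff_mult_less_eq)
    have "g * x \<le> n" "g * y \<le> n"
      using range unfolding abcd by simp_all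
    moreover have "x \<le> g * x" "y \<le> g * y"
      using pos by simp_all
    ultimately have "x \<le> n" "y \<le> n"
      by linarith+
    hence "(x, y) \<in> ratio_pairs n"
      using pos cop by (auto simp: ratio_pairs_def)
    hence "((x, y), (g, h)) \<in> params"
      using gh pos by (auto simp: params_def box_def)
    moreover have "z = quad ((x, y), (g, h))"
      by (simp add: quad_def z abcd)
    ultimately show "z \<in> quad ` params" by blast
  qed
  hence "card ?E \<le> card (quad ` params)"
    by (rule card_mono[OF finite_imageI[OF fin]])
  also have "\<dots> \<le> card params"
    by (rule card_image_le[OF fin])
  also have "card params = (\<Sum>p\<in>ratio_pairs n. card (box p))"
    unfolding params_def by (rule card_SigmaI) (auto simp: box_def)
  finally have "real (card ?E) \<le> real (\<Sum>p\<in>ratio_pairs n. card (box p))"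
    by (rule of_nat_mono)
  also have "\<dots> = (\<Sum>p\<in>ratio_pairs n. real (card (box p)))"
    by (rule of_nat_sum)
  also have "\<dots> \<le> (\<Sum>(x, y)\<in>ratio_pairs n. real n ^ 2 * (1 / real (max x y) ^ 2))"
  proof (rule sum_mono, clarify)
    fix x y
    have "real (n div max x y) \<le> real n / real (max x y)"
      by (rule of_nat_div_le_of_nat)
    hence "real (n div max x y) ^ 2 \<le> (real n / real (max x y)) ^ 2"
      by (intro power_mono) auto
    thus "real (card (box (x, y))) \<le> real n ^ 2 * (1 / real (max x y) ^ 2)"
      by (simp add: box_def card_cartesian_product power2_eq_square)
  qed
  also have "\<dots> = real n ^ 2 * (\<Sum>(x, y)\<in>ratio_pairs n. 1 / real (max x y) ^ 2)"
    by (simp add: sum_distrib_left case_prod_unfold)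
  also have "\<dots> \<le> real n ^ 2 * (1 + 2 * ln (real n))"
    using sum_ratio_pairs_le[OF assms] by (intro mult_left_mono) auto
  finally show ?thesis .
qed

lemma mult_table_count_ge:
  assumes "n \<ge> 1"
  shows "real n ^ 2 \<le> real (mult_table_count n) * (1 + 2 * ln (real n))"
proof -
  let ?P = "{1..n} \<times> {1..n}" and ?f = "\<lambda>p. fst p * snd p"
  let ?M = "real (mult_table_count n)"
  have "{i * j | i j. 1 \<le> i \<and> i \<le> n \<and> 1 \<le> j \<and> j \<le> n} = ?f ` ?P"
    by (force simp: image_iff)
  hence "mult_table_count n = card (?f ` ?P)"
    unfolding mult_table_count_def by simp
  hence "real (card ?P) ^ 2
      \<le> ?M * real (card {(p, q). p \<in> ?P \<and> q \<in> ?P \<and> ?f p = ?f q})"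
    using card_squared_le_card_image_mult_collisions[of ?P ?f] by simp
  also have "\<dots> \<le> ?M * (real n ^ 2 * (1 + 2 * ln (real n)))"
    by (intro mult_left_mono mult_energy_le assms) simp
  finally have "real n ^ 2 * real n ^ 2 \<le> real n ^ 2 * (?M * (1 + 2 * ln (real n)))"
    by (simp add: card_cartesian_product power2_eq_square mult_ac)
  thus ?thesis
    using assms by (subst (asm) mult_le_cancel_left_pos) auto
qed

section \<open>Comparison with the divisor-type bound\<close>

text \<open>
  Write \<open>L = ln m\<close> and \<open>u = ln L > 0\<close>. Then \<open>1 + L \<le> exp (u + 1)\<close>, so it suffices that the exponent
  \<open>L * ln 2 * (u + 387 / 200) / u\<^sup>2\<close> of \<open>frakN m\<close> is at least \<open>u + 1\<close>. The tangent line of \<open>exp\<close>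
  at \<open>1\<close>, evaluated at \<open>u / 2\<close> and squared, gives \<open>L = exp u \<ge> (exp 1 * u / 2)\<^sup>2 \<ge> 25 / 16 * u\<^sup>2\<close>;
  together with \<open>ln 2 \<ge> 2 / 3\<close> this bounds the exponent below by \<open>25 / 24 * (u + 387 / 200)\<close>.
\<close>

lemma one_plus_ln_le_frakN:
  assumes "ln (real m) > 1"
  shows "1 + ln (real m) \<le> frakN m"
proof -
  define L where "L = ln (real m)"
  define u where "u = ln L"
  have "L > 1" using assms by (simp add: L_def)
  hence "u > 0" and L_exp: "L = exp u" by (simp_all add: u_def)
  have "m > 0" using assms by (cases m) auto
  have e: "exp 1 \<ge> (5/2 :: real)"
    using exp_lower_Taylor_quadratic[of 1] by simp
  have "5/2 * (u/2) \<le> exp 1 * (u/2)"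
    using e \<open>u > 0\<close> by (intro mult_right_mono) auto
  also have "\<dots> \<le> exp 1 * exp (u/2 - 1)"
    using exp_ge_add_one_self[of "u/2 - 1"] by (intro mult_left_mono) auto
  also have "\<dots> = exp (u/2)"
    by (simp flip: exp_add)
  finally have "(5/2 * (u/2)) ^ 2 \<le> exp (u/2) ^ 2"
    using \<open>u > 0\<close> by (intro power_mono) auto
  also have "exp (u/2) ^ 2 = L"
    by (simp add: L_exp power2_eq_square flip: exp_add)
  finally have L_ge: "25/16 * u^2 \<le> L"
    by (simp add: power2_eq_square)
  have "(25/16 * u^2) * (2/3) \<le> L * ln 2"
    using L_ge ln2_ge_two_thirds \<open>L > 1\<close> by (intro mult_mono) auto
  hence "25/24 \<le> L * ln 2 / u^2"
    using \<open>u > 0\<close> by (simp add: field_simps)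
  hence "25/24 * (u + 387/200) \<le> L * ln 2 / u^2 * (u + 387/200)"
    using \<open>u > 0\<close> by (intro mult_right_mono) auto
  also have "\<dots> = (ln 2 / u * (1 + 387 / (200 * u))) * L"
    using \<open>u > 0\<close> by (simp add: field_simps power2_eq_square)
  finally have exponent: "u + 1 \<le> (ln 2 / u * (1 + 387 / (200 * u))) * L"
    using \<open>u > 0\<close> by simp
  have "1 + L \<le> 2 * L" using \<open>L > 1\<close> by simp
  also have "\<dots> \<le> exp 1 * L"
    using e \<open>L > 1\<close> by (intro mult_right_mono) auto
  also have "\<dots> = exp (u + 1)"
    by (simp add: L_exp exp_add)
  also have "\<dots> \<le> exp ((ln 2 / u * (1 + 387 / (200 * u))) * L)"
    using exponent by simp
  also have "\<dots> = frakN m"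
    using \<open>m > 0\<close> by (simp add: frakN_def powr_def L_def u_def)
  finally show ?thesis by (simp add: L_def)
qed

theorem theorem4p1:
  fixes n :: nat
  assumes "n \<ge> 2"
  shows "real (mult_table_count n) \<ge> real (n ^ 2) / frakN (n ^ 2)"
proof -
  have L: "ln (real (n ^ 2)) = 2 * ln (real n)"
    using assms by (simp add: ln_realpow)
  have "ln 2 \<le> ln (real n)"
    using assms by simp
  hence big: "ln (real (n ^ 2)) > 1"
    using ln2_ge_two_thirds unfolding L by linarith
  have le: "1 + 2 * ln (real n) \<le> frakN (n ^ 2)"
    using one_plus_ln_le_frakN[OF big] unfolding L .
  have pos: "frakN (n ^ 2) > 0"
    using le big unfolding L by linarith
  have "real (n ^ 2) \<le> real (mult_table_count n) * (1 + 2 * ln (real n))"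
    using mult_table_count_ge[of n] assms by simp
  also have "\<dots> \<le> real (mult_table_count n) * frakN (n ^ 2)"
    using le by (intro mult_left_mono) auto
  finally show ?thesis
    using pos by (simp add: pos_divide_le_eq)
qed

end
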